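(* Let $\mathcal{A}$ be a Banach algebra and $\varphi\in\mathcal{A}^{*}$. Then $\varphi$ is right tame if and only if $B_{\mathcal{A}^{**}}\circledast\varphi$ (which equals the weak-star closure $\overline{B_{\mathcal{A}}\circledast\varphi}^{w^{*}}$) is co-tame. Similarly, $\varphi$ is left tame if and only if $\varphi\circledast B_{\mathcal{A}^{**}}$ is co-tame.
   Context: All vector spaces are over $\mathbb{R}$; $B_{V}$ is the closed unit ball of a Banach space $V$. For $a,b\in\mathcal{A}$, $\varphi\in\mathcal{A}^{*}$: $\langle a\circledast\varphi,b\rangle:=\langle\varphi,ba\rangle$ and $\langle\varphi\circledast a,b\rangle:=\langle\varphi,ab\rangle$. For $\mu\in\mathcal{A}^{**}$: $\langle\mu\circledast\varphi,b\rangle:=\langle\mu,\varphi\circledast b\rangle$ and $\langle\varphi\circledast\mu,b\rangle:=\langle\mu,b\circledast\varphi\rangle$. For sets, $B_{\mathcal{A}^{**}}\circledast\varphi=\{\mu\circledast\varphi:\mu\in B_{\mathcal{A}^{**}}\}$, and similarly for $\varphi\circledast B_{\mathcal{A}^{**}}$, $B_{\mathcal{A}}\circledast\varphi$, $\varphi\circledast B_{\mathcal{A}}$. The sets $B_{\mathcal{A}^{**}}\circledast\varphi$ and $\varphi\circledast B_{\mathcal{A}^{**}}$ are weak-star compact in $\mathcal{A}^{*}$. A bounded family $\{f_{n}\}_{n\in\mathbb{N}}$ of real functions on a set $X$ is independent if there are reals $a<b$ such that for all finite disjoint $N,M\subseteq\mathbb{N}$ there is $x\in X$ with $f_{n}(x)\le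 a$ for $n\in N$ and $f_{m}(x)\ge b$ for $m\in M$. A bounded subset $C$ of a Banach space $V$ is tame if it contains no $\ell^{1}$-sequence; equivalently, every sequence in $C$ has a weak-Cauchy subsequence; equivalently, $C$ contains no sequence that is independent over $B_{V^{*}}$. A weak-star compact subset $M\subseteq V^{*}$ is co-tame if $B_{V}$ is tame as a family of functions on $M$, i.e. $B_{V}$ contains no sequence that is independent over $M$. $\varphi\in\mathcal{A}^{*}$ is right tame if $\varphi\circledast B_{\mathcal{A}}$ is a tame subset of $\mathcal{A}^{*}$, and left tame if $B_{\mathcal{A}}\circledast\varphi$ is a tame subset of $\mathcal{A}^{*}$. *)

theory Defs
  imports "HOL-Analysis.Analysis"
begin

text \<open>
  A Banach algebra is a type of sort {real_normed_algebra, banach}: no unit and no commutativity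
  are assumed. The dual of \<open>'v\<close> is \<open>'v \<Rightarrow>\<^sub>L real\<close> with the operator norm.
\<close>

type_synonym 'v dual = "'v \<Rightarrow>\<^sub>L real"
type_synonym 'v bidual = "'v dual \<Rightarrow>\<^sub>L real"

text \<open>For functionals, pointwise convergence is the weak-star topology.\<close>

abbreviation weak_star_topology :: "('v::real_normed_vector) dual topology" where
  "weak_star_topology \<equiv> strong_operator_topology"


section \<open>Module actions on the dual\<close>

text \<open>
  All four actions are written \<open>\<circledast>\<close> in the mathematical notation; here \<open>\<triangleright>\<close> has the functional
  on its right and \<open>\<triangleleft>\<close> has it on its left, and a subscript marks the action of the bidual.
  Each definition is followed by its evaluation rule, which shows that \<open>Blinfun\<close> is applied to a
  bounded linear map and so yields no junk value.
\<close>

definition left_act :: "'a::real_normed_algebra \<Rightarrow> 'a dual \<Rightarrow> 'a dual" (infixr "\<triangleright>" 75) where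
  "a \<triangleright> \<phi> = Blinfun (\<lambda>b. \<phi> (b * a))"

definition right_act :: "'a::real_normed_algebra dual \<Rightarrow> 'a \<Rightarrow> 'a dual" (infixl "\<triangleleft>" 75) where
  "\<phi> \<triangleleft> a = Blinfun (\<lambda>b. \<phi> (a * b))"

lemma left_act_apply [simp]: "blinfun_apply (a \<triangleright> \<phi>) b = \<phi> (b * a)"
  unfolding left_act_def
  by (subst bounded_linear_Blinfun_apply)
     (intro bounded_linear_compose[OF blinfun.bounded_linear_right bounded_linear_mult_left] refl)+

lemma right_act_apply [simp]: "blinfun_apply (\<phi> \<triangleleft> a) b = \<phi> (a * b)"
  unfolding right_act_def
  by (subst bounded_linear_Blinfun_apply)
     (intro bounded_linear_compose[OF blinfun.bounded_linear_right bounded_linear_mult_right] refl)+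

lemma bounded_linear_left_act: "bounded_linear (\<lambda>a. a \<triangleright> \<phi>)"
proof (rule bounded_linear_intro)
  show "norm (a \<triangleright> \<phi>) \<le> norm a * norm \<phi>" for a
  proof (rule norm_blinfun_bound)
    fix b
    have "norm (\<phi> (b * a)) \<le> norm \<phi> * norm (b * a)" by (rule norm_blinfun)
    also have "\<dots> \<le> norm \<phi> * (norm b * norm a)"
      by (intro mult_left_mono norm_mult_ineq norm_ge_zero)
    finally show "norm ((a \<triangleright> \<phi>) b) \<le> norm a * norm \<phi> * norm b" by (simp add: mult_ac)
  qed simp
qed (auto intro!: blinfun_eqI simp: blinfun.bilinear_simps algebra_simps)

lemma bounded_linear_right_act: "bounded_linear (\<lambda>a. \<phi> \<triangleleft> a)"
proof (rule bounded_linear_intro)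
  show "norm (\<phi> \<triangleleft> a) \<le> norm a * norm \<phi>" for a
  proof (rule norm_blinfun_bound)
    fix b
    have "norm (\<phi> (a * b)) \<le> norm \<phi> * norm (a * b)" by (rule norm_blinfun)
    also have "\<dots> \<le> norm \<phi> * (norm a * norm b)"
      by (intro mult_left_mono norm_mult_ineq norm_ge_zero)
    finally show "norm ((\<phi> \<triangleleft> a) b) \<le> norm a * norm \<phi> * norm b" by (simp add: mult_ac)
  qed simp
qed (auto intro!: blinfun_eqI simp: blinfun.bilinear_simps algebra_simps)

definition bidual_left_act :: "'a::real_normed_algebra bidual \<Rightarrow> 'a dual \<Rightarrow> 'a dual"
    (infixr "\<triangleright>\<^sub>2" 75) where
  "\<mu> \<triangleright>\<^sub>2 \<phi> = Blinfun (\<lambda>b. \<mu> (\<phi> \<triangleleft> b))"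

definition bidual_right_act :: "'a::real_normed_algebra dual \<Rightarrow> 'a bidual \<Rightarrow> 'a dual"
    (infixl "\<triangleleft>\<^sub>2" 75) where
  "\<phi> \<triangleleft>\<^sub>2 \<mu> = Blinfun (\<lambda>b. \<mu> (b \<triangleright> \<phi>))"

lemma bidual_left_act_apply [simp]: "blinfun_apply (\<mu> \<triangleright>\<^sub>2 \<phi>) b = \<mu> (\<phi> \<triangleleft> b)"
  unfolding bidual_left_act_def
  by (subst bounded_linear_Blinfun_apply)
     (intro bounded_linear_compose[OF blinfun.bounded_linear_right bounded_linear_right_act] refl)+

lemma bidual_right_act_apply [simp]: "blinfun_apply (\<phi> \<triangleleft>\<^sub>2 \<mu>) b = \<mu> (b \<triangleright> \<phi>)"
  unfolding bidual_right_act_def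
  by (subst bounded_linear_Blinfun_apply)
     (intro bounded_linear_compose[OF blinfun.bounded_linear_right bounded_linear_left_act] refl)+


section \<open>Tameness and co-tameness\<close>

definition independent_family_on :: "'x set \<Rightarrow> (nat \<Rightarrow> 'x \<Rightarrow> real) \<Rightarrow> bool" where
  "independent_family_on X f \<longleftrightarrow>
     (\<exists>K. \<forall>n. \<forall>x\<in>X. \<bar>f n x\<bar> \<le> K) \<and>
     (\<exists>a b. a < b \<and>
        (\<forall>N M. finite N \<and> finite M \<and> N \<inter> M = {} \<longrightarrow>
           (\<exists>x\<in>X. (\<forall>n\<in>N. f n x \<le> a) \<and> (\<forall>m\<in>M. f m x \<ge> b))))"

text \<open>An \<open>\<ell>\<^sup>1\<close>-sequence is one equivalent to the unit vector basis of \<open>\<ell>\<^sup>1\<close>.\<close>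

definition l1_sequence :: "(nat \<Rightarrow> 'v::real_normed_vector) \<Rightarrow> bool" where
  "l1_sequence v \<longleftrightarrow>
     (\<exists>c K. c > 0 \<and>
        (\<forall>n. \<forall>t :: nat \<Rightarrow> real.
           c * (\<Sum>i<n. \<bar>t i\<bar>) \<le> norm (\<Sum>i<n. t i *\<^sub>R v i) \<and>
           norm (\<Sum>i<n. t i *\<^sub>R v i) \<le> K * (\<Sum>i<n. \<bar>t i\<bar>)))"

definition tame :: "'v::banach set \<Rightarrow> bool" where
  "tame C \<longleftrightarrow> bounded C \<and> \<not> (\<exists>v. range v \<subseteq> C \<and> l1_sequence v)"

definition co_tame :: "'v::banach dual set \<Rightarrow> bool" where
  "co_tame M \<longleftrightarrow>
     compactin weak_star_topology M \<and>
     \<not> (\<exists>v. range v \<subseteq> cball 0 1 \<and> independent_family_on M (\<lambda>n \<psi>. blinfun_apply \<psi> (v n)))"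

definition right_tame :: "'a::{real_normed_algebra, banach} dual \<Rightarrow> bool" where
  "right_tame \<phi> \<longleftrightarrow> tame ((\<lambda>a. \<phi> \<triangleleft> a) ` cball 0 1)"

definition left_tame :: "'a::{real_normed_algebra, banach} dual \<Rightarrow> bool" where
  "left_tame \<phi> \<longleftrightarrow> tame ((\<lambda>a. a \<triangleright> \<phi>) ` cball 0 1)"

end

theory Submission
  imports Defs
begin

text \<open>
  Both equivalences concern the adjoint of a bounded linear map \<open>T\<close> from \<open>\<A>\<close> to \<open>\<A>\<^sup>*\<close>,
  namely \<open>T a = \<phi> \<triangleleft> a\<close> or \<open>T a = a \<triangleright> \<phi>\<close>: a sequence \<open>v\<close> in the unit ball is independent on
  the image of the bidual ball exactly when \<open>T \<circ> v\<close> is independent over the bidual ball.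
  An independent sequence is already an \<open>\<ell>\<^sup>1\<close>-sequence, because subtracting the values at two
  points with opposite sign patterns bounds the norm from below, so no subsequence is needed.
  Conversely, Helly's theorem turns the lower \<open>\<ell>\<^sup>1\<close>-estimate into points of the unit ball of
  \<open>\<A>\<close> realising every sign pattern approximately. Helly's theorem together with the
  Banach-Alaoglu theorem also gives the description of the image as a weak-star closure.
\<close>

section \<open>Helly's theorem\<close>

text \<open>The ball is symmetric, so a one-sided bound at \<open>sgn x\<close> and
  \<open>- sgn x\<close> bounds the absolute value; scaling by \<open>norm x\<close> gives the
  rest.\<close>

lemma norm_blinfun_le_if_le_on_cball:
  fixes f :: "'v::real_normed_vector dual"
  assumes "\<And>w. norm w \<le> 1 \<Longrightarrow> f w \<le> L"
  shows "norm f \<le> L"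
proof (rule norm_blinfun_bound)
  show "0 \<le> L" using assms[of 0] by (simp add: blinfun.zero_right)
  show "norm (f x) \<le> L * norm x" for x
  proof (cases "x = 0")
    case False
    have "f (sgn x) \<le> L" "f (- sgn x) \<le> L" by (rule assms; simp add: norm_sgn)+
    then have "\<bar>f (sgn x)\<bar> \<le> L" by (simp add: blinfun.minus_right)
    moreover have "f x = norm x * f (sgn x)"
      using False by (simp add: sgn_div_norm blinfun.scaleR_right)
    ultimately show ?thesis by (simp add: abs_mult mult.commute[of L] mult_left_mono)
  qed (simp add: blinfun.zero_right)
qed

text \<open>
  If \<open>y\<close> stays at positive distance \<open>m\<close> from the image of the ball, then for a near-minimiser \<open>v\<close>
  of the distance the residual \<open>r i = x i v - y i\<close> separates \<open>y\<close> from that image.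
\<close>

lemma helly:
  fixes x :: "'i \<Rightarrow> 'v::real_normed_vector dual" and y :: "'i \<Rightarrow> real"
  assumes "finite I" and "\<delta> > 0"
    and le: "\<And>t. (\<Sum>i\<in>I. t i * y i) \<le> norm (\<Sum>i\<in>I. t i *\<^sub>R x i)"
  obtains v where "norm v \<le> 1" and "\<And>i. i \<in> I \<Longrightarrow> \<bar>x i v - y i\<bar> \<le> \<delta>"
proof -
  define F where "F v = (\<Sum>i\<in>I. (x i v - y i)\<^sup>2)" for v
  define m where "m = Inf (F ` cball 0 1)"
  have F_nonneg: "F v \<ge> 0" for v unfolding F_def by (simp add: sum_nonneg)
  then have bdd: "bdd_below (F ` cball 0 1)" by (rule bdd_belowI2)
  have m_le: "m \<le> F v" if "norm v \<le> 1" for v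
    unfolding m_def using that bdd by (intro cInf_lower) auto
  have "m \<le> 0"
  proof (rule ccontr)
    assume "\<not> m \<le> 0"
    then have "m > 0" by simp
    \<comment> \<open>\<open>D\<close> bounds the second-order term uniformly over the ball. A move
      of size \<open>s\<close> costs at most \<open>s * (s * D)\<close>, which this choice of
      \<open>s\<close> keeps below \<open>s * (m / 2)\<close>; the summand 1 keeps the denominator
      positive when \<open>D = 0\<close>.\<close>
    define D where "D = (\<Sum>i\<in>I. (2 * norm (x i))\<^sup>2)"
    have "D \<ge> 0" unfolding D_def by (simp add: sum_nonneg)
    define s where "s = min 1 (m / (2 * (D + 1)))"
    have s: "0 < s" "s \<le> 1" and sD: "s * D \<le> m / 2"
    proof -
      show "0 < s" "s \<le> 1" using \<open>m > 0\<close> \<open>D \<ge> 0\<close> by (auto simp: s_def)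
      have "s * D \<le> m / (2 * (D + 1)) * (D + 1)"
        using \<open>m > 0\<close> \<open>D \<ge> 0\<close> by (intro mult_mono) (auto simp: s_def)
      also have "\<dots> = m / 2" using \<open>D \<ge> 0\<close> by (simp add: divide_simps)
      finally show "s * D \<le> m / 2" .
    qed
    \<comment> \<open>The slack in near-minimality is proportional to \<open>s\<close>, so that it
      survives the later division by \<open>s\<close> as only \<open>m / 2\<close>.\<close>
    have "\<exists>z\<in>F ` cball 0 1. z < m + s * (m / 2)"
      using \<open>m > 0\<close> s cInf_lessD[of "F ` cball 0 1" "m + s * (m / 2)"] by (auto simp: m_def)
    then obtain v where v: "norm v \<le> 1" and Fv: "F v < m + s * (m / 2)" by auto
    define r where "r i = x i v - y i" for i
    \<comment> \<open>First-order optimality: moving from \<open>v\<close> towards \<open>w\<close>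
      stays in the ball, so \<open>F\<close> is still at least \<open>m\<close> there. Expanding the
      square and cancelling \<open>s\<close> bounds the sum of \<open>r i * q i\<close> below by
      \<open>- m / 2\<close>.\<close>
    have "(\<Sum>i\<in>I. (- r i) *\<^sub>R x i) w \<le> (\<Sum>i\<in>I. (- r i) * y i) - m / 2" if w: "norm w \<le> 1" for w
    proof -
      define q where "q i = x i w - x i v" for i
      have "norm ((1 - s) *\<^sub>R v + s *\<^sub>R w) \<le> (1 - s) * 1 + s * 1"
        using v w s by (intro norm_triangle_le add_mono) (auto simp: mult_left_le)
      then have "m \<le> F ((1 - s) *\<^sub>R v + s *\<^sub>R w)" by (intro m_le) simp
      also have "\<dots> = (\<Sum>i\<in>I. (r i + s * q i)\<^sup>2)"
        unfolding F_def r_def q_def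
        by (simp add: blinfun.bilinear_simps algebra_simps)
      also have "\<dots> = F v + 2 * s * (\<Sum>i\<in>I. r i * q i) + s * (s * (\<Sum>i\<in>I. (q i)\<^sup>2))"
        unfolding F_def r_def[symmetric]
        by (simp add: sum.distrib sum_distrib_left power2_eq_square algebra_simps)
      also have "(\<Sum>i\<in>I. (q i)\<^sup>2) \<le> D"
        unfolding D_def
      proof (rule sum_mono)
        fix i
        have "\<bar>x i w\<bar> \<le> norm (x i)" "\<bar>x i v\<bar> \<le> norm (x i)"
          using norm_blinfun[of "x i" w] norm_blinfun[of "x i" v]
            mult_left_le[OF w norm_ge_zero[of "x i"]] mult_left_le[OF v norm_ge_zero[of "x i"]] by auto
        then have "\<bar>q i\<bar> \<le> \<bar>2 * norm (x i)\<bar>" unfolding q_def by linarith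
        then show "(q i)\<^sup>2 \<le> (2 * norm (x i))\<^sup>2" by (simp only: abs_le_square_iff)
      qed
      finally have "m \<le> F v + 2 * s * (\<Sum>i\<in>I. r i * q i) + s * (s * D)"
        using s by (simp add: mult_left_mono)
      also have "\<dots> \<le> m + s * (m / 2) + 2 * s * (\<Sum>i\<in>I. r i * q i) + s * (m / 2)"
        using Fv sD s by (intro add_mono mult_left_mono) auto
      finally have "0 \<le> s * (m + 2 * (\<Sum>i\<in>I. r i * q i))" by (simp add: algebra_simps)
      then have rq: "0 \<le> m + 2 * (\<Sum>i\<in>I. r i * q i)"
        using s by (simp add: zero_le_mult_iff)
      \<comment> \<open>Since \<open>x i w = y i + q i + r i\<close>, the squares of the residual
        contribute at least \<open>m\<close>; this outweighs the cross term and leaves a gap of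
        \<open>m / 2\<close>.\<close>
      have "m \<le> (\<Sum>i\<in>I. r i * r i)"
        using m_le[OF v] unfolding F_def r_def by (simp add: power2_eq_square)
      moreover have "(\<Sum>i\<in>I. r i * x i w) = (\<Sum>i\<in>I. r i * y i) + (\<Sum>i\<in>I. r i * q i) + (\<Sum>i\<in>I. r i * r i)"
        unfolding sum.distrib[symmetric] by (rule sum.cong) (simp_all add: q_def r_def algebra_simps)
      moreover have "(\<Sum>i\<in>I. (- r i) *\<^sub>R x i) w = - (\<Sum>i\<in>I. r i * x i w)"
        by (simp add: blinfun.bilinear_simps blinfun.sum_left sum_negf)
      ultimately show ?thesis using rq by (simp add: sum_negf)
    qed
    then have "norm (\<Sum>i\<in>I. (- r i) *\<^sub>R x i) \<le> (\<Sum>i\<in>I. (- r i) * y i) - m / 2"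
      by (rule norm_blinfun_le_if_le_on_cball)
    with le[of "\<lambda>i. - r i"] \<open>m > 0\<close> show False by simp
  qed
  then have "\<exists>z\<in>F ` cball 0 1. z < \<delta>\<^sup>2"
    using \<open>\<delta> > 0\<close> unfolding m_def
    by (intro cInf_lessD) (auto intro: le_less_trans[where y = 0])
  then obtain v where v: "norm v \<le> 1" "F v < \<delta>\<^sup>2" by auto
  have "\<bar>x i v - y i\<bar> \<le> \<delta>" if "i \<in> I" for i
  proof -
    have "(x i v - y i)\<^sup>2 \<le> F v"
      unfolding F_def using that \<open>finite I\<close> by (intro member_le_sum) auto
    with v(2) have "(x i v - y i)\<^sup>2 \<le> \<delta>\<^sup>2" by simp
    then show ?thesis using \<open>\<delta> > 0\<close> by (simp add: abs_le_square_iff[symmetric])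
  qed
  with v(1) that show ?thesis by blast
qed

text \<open>The canonical embedding into the bidual.\<close>

lift_definition eval_functional :: "'v::real_normed_vector \<Rightarrow> 'v bidual" is
  "\<lambda>v f. blinfun_apply f v"
  by (rule blinfun.bounded_linear_left)

lemma norm_eval_functional_le: "norm (eval_functional v) \<le> norm v"
proof (rule norm_blinfun_bound)
  show "norm (eval_functional v f) \<le> norm v * norm f" for f
    using norm_blinfun[of f v] by (simp add: eval_functional.rep_eq mult.commute)
qed simp

text \<open>Weak-star density of the ball in the bidual ball, in coordinates: the values
  \<open>\<mu> (x i)\<close> satisfy Helly's condition because
  \<open>norm \<mu> \<le> 1\<close>.\<close>

lemma goldstine:
  fixes x :: "'i \<Rightarrow> 'v::real_normed_vector dual" and \<mu> :: "'v bidual"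
  assumes "finite I" "\<delta> > 0" "norm \<mu> \<le> 1"
  obtains v where "norm v \<le> 1" and "\<And>i. i \<in> I \<Longrightarrow> \<bar>x i v - \<mu> (x i)\<bar> \<le> \<delta>"
proof (rule helly[OF assms(1,2)])
  fix t
  have "(\<Sum>i\<in>I. t i * \<mu> (x i)) = \<mu> (\<Sum>i\<in>I. t i *\<^sub>R x i)"
    by (simp add: blinfun.sum_right blinfun.scaleR_right)
  also have "\<dots> \<le> norm \<mu> * norm (\<Sum>i\<in>I. t i *\<^sub>R x i)"
    using norm_blinfun[of \<mu> "\<Sum>i\<in>I. t i *\<^sub>R x i"] by simp
  also have "\<dots> \<le> norm (\<Sum>i\<in>I. t i *\<^sub>R x i)"
    using assms(3) by (simp add: mult_left_le_one_le)
  finally show "(\<Sum>i\<in>I. t i * \<mu> (x i)) \<le> norm (\<Sum>i\<in>I. t i *\<^sub>R x i)" .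
qed (use that in blast)

section \<open>The weak-star topology\<close>

text \<open>Banach-Alaoglu: the linear functions form a closed subset of a product of compact
  intervals, and \<open>Blinfun\<close> maps this compact set continuously onto the dual
  ball.\<close>

lemma compactin_weak_star_cball:
  "compactin weak_star_topology (cball 0 1 :: 'v::real_normed_vector dual set)"
proof -
  define L where "L = {f :: 'v \<Rightarrow> real. (\<forall>x. f x \<in> {- norm x..norm x}) \<and>
    (\<forall>x y. f (x + y) = f x + f y) \<and> (\<forall>c x. f (c *\<^sub>R x) = c * f x)}"
  \<comment> \<open>On \<open>L\<close> the map \<open>Blinfun\<close> takes no default value, so
    \<open>Blinfun f x\<close> is the coordinate \<open>f x\<close>, which is continuous in
    \<open>f\<close>.\<close>
  have bl: "bounded_linear f" if "f \<in> L" for f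
    using that by (intro bounded_linear_intro[where K = 1]) (auto simp: L_def abs_le_iff minus_le_iff)
  have "compactin euclidean (\<Pi>\<^sub>E x\<in>(UNIV :: 'v set). {- norm x..norm x})"
    by (subst euclidean_product_topology[symmetric]) (simp add: compactin_PiE)
  then have "compact (\<Pi>\<^sub>E x\<in>(UNIV :: 'v set). {- norm x..norm x})" by simp
  moreover have "closed ((\<Inter>x y. {f :: 'v \<Rightarrow> real. f (x + y) = f x + f y}) \<inter>
      (\<Inter>c x. {f. f (c *\<^sub>R x) = c * f x}))"
    by (intro closed_Int closed_INT closed_Collect_eq ballI continuous_intros
        continuous_on_product_coordinates)
  moreover have "L = (\<Pi>\<^sub>E x\<in>UNIV. {- norm x..norm x}) \<inter>
      ((\<Inter>x y. {f. f (x + y) = f x + f y}) \<inter> (\<Inter>c x. {f. f (c *\<^sub>R x) = c * f x}))"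
    by (auto simp: L_def PiE_def Pi_def extensional_def)
  ultimately have "compact L" by (simp add: compact_Int_closed)
  then have "compactin (top_of_set L) L" by (simp add: compactin_subtopology)
  moreover have "continuous_map (top_of_set L) weak_star_topology Blinfun"
    unfolding continuous_on_strong_operator_topo_iff_coordinatewise
  proof
    fix x
    have "continuous_on L (\<lambda>f. f x)"
      by (rule continuous_on_subset[OF continuous_on_product_coordinates]) simp
    then show "continuous_map (top_of_set L) euclidean (\<lambda>f. Blinfun f x)"
      by (simp add: bl bounded_linear_Blinfun_apply cong: continuous_on_cong)
  qed
  ultimately have "compactin weak_star_topology (Blinfun ` L)" by (rule image_compactin)
  moreover have "Blinfun ` L = cball 0 1"
  proof (intro equalityI subsetI)
    fix f :: "'v dual" assume "f \<in> Blinfun ` L"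
    then obtain g where g: "g \<in> L" "f = Blinfun g" by blast
    have "norm f \<le> 1"
      by (rule norm_blinfun_bound)
        (use g bl in \<open>auto simp: bounded_linear_Blinfun_apply L_def abs_le_iff minus_le_iff\<close>)
    then show "f \<in> cball 0 1" by simp
  next
    fix f :: "'v dual" assume f: "f \<in> cball 0 1"
    have "\<bar>f x\<bar> \<le> norm x" for x
      using norm_blinfun[of f x] f mult_left_le_one_le[of "norm x" "norm f"] by auto
    then have "blinfun_apply f \<in> L"
      by (auto simp: L_def blinfun.bilinear_simps abs_le_iff minus_le_iff)
    then show "f \<in> Blinfun ` L"
      by (metis blinfun_apply_inverse image_eqI)
  qed
  ultimately show ?thesis by simp
qed

text \<open>Evaluation at a point where two functionals differ separates them. This makes weak-star
  compact sets closed.\<close>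

lemma Hausdorff_weak_star: "Hausdorff_space (weak_star_topology :: 'v::real_normed_vector dual topology)"
  unfolding Hausdorff_space_def
proof (intro allI impI, elim conjE)
  fix f g :: "'v dual" assume "f \<noteq> g"
  then obtain x where "f x \<noteq> g x" by (meson blinfun_eqI)
  then obtain U V where UV: "open U" "open V" "f x \<in> U" "g x \<in> V" "U \<inter> V = {}"
    by (metis hausdorff)
  have "openin weak_star_topology {h :: 'v dual. h x \<in> W}" if "open W" for W
    using strong_operator_topology_basis[of "{()}" "\<lambda>_. W" "\<lambda>_. x"] that by simp
  then show "\<exists>U V. openin weak_star_topology U \<and> openin weak_star_topology V \<and>
      f \<in> U \<and> g \<in> V \<and> disjnt U V"
    using UV by (intro exI[of _ "{h :: 'v dual. h x \<in> U}"] exI[of _ "{h :: 'v dual. h x \<in> V}"])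
      (auto simp: disjnt_iff)
qed

text \<open>A basic neighbourhood constrains only finitely many coordinates, so a common tolerance
  on finite sets suffices; this is the form of approximation that \<open>goldstine\<close>
  supplies.\<close>

lemma weak_star_closure_ofI:
  fixes f :: "'v::real_normed_vector dual" and S :: "'v dual set"
  assumes "\<And>I \<delta>. finite I \<Longrightarrow> \<delta> > 0 \<Longrightarrow> \<exists>g\<in>S. \<forall>x\<in>I. \<bar>g x - f x\<bar> \<le> \<delta>"
  shows "f \<in> weak_star_topology closure_of S"
  unfolding in_closure_of
proof (intro conjI allI impI; (elim conjE)?)
  show "f \<in> topspace weak_star_topology" by (simp add: strong_operator_topology_topspace)
  fix W :: "'v dual set" assume f: "f \<in> W" and "openin weak_star_topology W"
  then obtain U where U: "open U" "W = blinfun_apply -` U"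
    unfolding strong_operator_topology_def openin_pullback_topology by auto
  with f have "openin (product_topology (\<lambda>_. euclidean) UNIV) U" "blinfun_apply f \<in> U"
    by (auto simp: euclidean_product_topology)
  then obtain X where X: "blinfun_apply f \<in> (\<Pi>\<^sub>E i\<in>UNIV. X i)" "\<And>i. open (X i)"
      "finite {i. X i \<noteq> UNIV}" "(\<Pi>\<^sub>E i\<in>UNIV. X i) \<subseteq> U"
    using product_topology_open_contains_basis[of "\<lambda>_. euclidean" UNIV U "blinfun_apply f"]
    by auto
  define I where "I = {i. X i \<noteq> UNIV}"
  have "\<forall>i. \<exists>e>0. cball (f i) e \<subseteq> X i"
    using X(1,2) open_contains_cball by (metis PiE_iff UNIV_I)
  then obtain e where e: "\<And>i. e i > 0" "\<And>i. cball (f i) (e i) \<subseteq> X i" by metis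
  \<comment> \<open>Inserting 1 keeps the minimum meaningful and positive when \<open>I\<close> is
    empty.\<close>
  define \<delta> where "\<delta> = Min (insert 1 (e ` I))"
  have "finite I" using X(3) by (simp add: I_def)
  then have \<delta>: "\<delta> > 0" "\<And>i. i \<in> I \<Longrightarrow> \<delta> \<le> e i" using e(1) by (auto simp: \<delta>_def)
  obtain g where g: "g \<in> S" "\<And>i. i \<in> I \<Longrightarrow> \<bar>g i - f i\<bar> \<le> \<delta>"
    using assms[OF \<open>finite I\<close> \<delta>(1)] by blast
  have "g i \<in> X i" for i
  proof (cases "i \<in> I")
    case True
    then have "g i \<in> cball (f i) (e i)" using g(2) \<delta>(2) by (force simp: dist_real_def abs_minus_commute)
    then show ?thesis using e(2) by blast
  qed (simp add: I_def)
  then have "g \<in> W" using X(4) U(2) by auto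
  with g(1) show "\<exists>g. g \<in> S \<and> g \<in> W" by blast
qed

section \<open>Adjoints of bounded linear maps into a dual space\<close>

text \<open>The hypothesis makes \<open>S\<close> the adjoint of \<open>T\<close>: the coordinate of
  \<open>S \<mu>\<close> at \<open>b\<close> is the evaluation of \<open>\<mu>\<close> at
  \<open>T b\<close>. Hence \<open>S\<close> is weak-star continuous and preserves the compactness
  of the bidual ball.\<close>

lemma compactin_image_bidual_cball:
  fixes T :: "'u::real_normed_vector \<Rightarrow> 'v::real_normed_vector dual"
    and S :: "'v bidual \<Rightarrow> 'u dual"
  assumes "\<And>\<mu> b. S \<mu> b = \<mu> (T b)"
  shows "compactin weak_star_topology (S ` cball 0 1)"
proof (rule image_compactin[OF compactin_weak_star_cball])
  show "continuous_map weak_star_topology weak_star_topology S"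
    unfolding continuous_on_strong_operator_topo_iff_coordinatewise
    by (simp add: assms strong_operator_topology_continuous_evaluation)
qed

text \<open>\<open>R\<close> is \<open>S\<close> restricted along the canonical embedding. Goldstine
  gives density of its image of the ball; compactness in a Hausdorff space gives closedness of the
  larger image.\<close>

lemma image_bidual_cball_eq_closure:
  fixes T :: "'u::real_normed_vector \<Rightarrow> 'v::real_normed_vector dual"
    and S :: "'v bidual \<Rightarrow> 'u dual" and R :: "'v \<Rightarrow> 'u dual"
  assumes S: "\<And>\<mu> b. S \<mu> b = \<mu> (T b)" and R: "\<And>a b. R a b = T b a"
  shows "S ` cball 0 1 = weak_star_topology closure_of (R ` cball 0 1)"
proof
  show "S ` cball 0 1 \<subseteq> weak_star_topology closure_of (R ` cball 0 1)"
  proof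
    fix f assume "f \<in> S ` cball 0 1"
    then obtain \<mu> where \<mu>: "norm \<mu> \<le> 1" "f = S \<mu>" by auto
    show "f \<in> weak_star_topology closure_of (R ` cball 0 1)"
    proof (rule weak_star_closure_ofI)
      fix I :: "'u set" and \<delta> :: real assume "finite I" "\<delta> > 0"
      then obtain v where "norm v \<le> 1" "\<And>i. i \<in> I \<Longrightarrow> \<bar>T i v - \<mu> (T i)\<bar> \<le> \<delta>"
        using goldstine[where x = T] \<mu>(1) by metis
      then show "\<exists>g\<in>R ` cball 0 1. \<forall>x\<in>I. \<bar>g x - f x\<bar> \<le> \<delta>"
        by (intro bexI[of _ "R v"]) (auto simp: \<mu>(2) S R)
    qed
  qed
  show "weak_star_topology closure_of (R ` cball 0 1) \<subseteq> S ` cball 0 1"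
  proof (rule closure_of_minimal)
    have "R a = S (eval_functional a)" for a
      by (rule blinfun_eqI) (simp add: S R eval_functional.rep_eq)
    then show "R ` cball 0 1 \<subseteq> S ` cball 0 1"
      using norm_eval_functional_le order_trans by fastforce
    show "closedin weak_star_topology (S ` cball 0 1)"
      using compactin_image_bidual_cball[of S T] S
      by (intro compactin_imp_closedin Hausdorff_weak_star) auto
  qed
qed

section \<open>Independence and \<ell>^1-estimates\<close>

lemma independent_imp_l1_sequence:
  fixes x :: "nat \<Rightarrow> 'v::real_normed_vector"
  assumes bdd: "\<And>n. norm (x n) \<le> K"
    and ind: "independent_family_on (cball 0 1) (\<lambda>n (\<mu> :: 'v dual). \<mu> (x n))"
  shows "l1_sequence x"
proof -
  obtain a b where "a < b" and ab: "\<And>N M. finite N \<Longrightarrow> finite M \<Longrightarrow> N \<inter> M = {} \<Longrightarrow>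
      \<exists>\<mu>\<in>cball (0 :: 'v dual) 1. (\<forall>n\<in>N. \<mu> (x n) \<le> a) \<and> (\<forall>m\<in>M. \<mu> (x m) \<ge> b)"
    using ind unfolding independent_family_on_def by metis
  have lower: "(b - a) / 2 * (\<Sum>i<n. \<bar>t i\<bar>) \<le> norm (\<Sum>i<n. t i *\<^sub>R x i)" for n and t :: "nat \<Rightarrow> real"
  proof -
    let ?s = "\<Sum>i<n. t i *\<^sub>R x i"
    define N where "N = {i. i < n \<and> t i < 0}"
    define M where "M = {i. i < n \<and> t i \<ge> 0}"
    have NM: "finite N" "finite M" "N \<inter> M = {}" "M \<inter> N = {}" by (auto simp: N_def M_def)
    obtain \<mu> :: "'v dual" where \<mu>: "norm \<mu> \<le> 1" "\<And>i. i \<in> N \<Longrightarrow> \<mu> (x i) \<le> a" "\<And>i. i \<in> M \<Longrightarrow> \<mu> (x i) \<ge> b"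
      using ab[OF NM(1,2,3)] by auto
    \<comment> \<open>With the two index sets exchanged, \<open>\<mu> - \<nu>\<close> is at least
      \<open>b - a\<close> on \<open>M\<close> and at most \<open>a - b\<close> on \<open>N\<close>,
      wherever \<open>a\<close> and \<open>b\<close> lie relative to 0.\<close>
    obtain \<nu> :: "'v dual" where \<nu>: "norm \<nu> \<le> 1" "\<And>i. i \<in> M \<Longrightarrow> \<nu> (x i) \<le> a" "\<And>i. i \<in> N \<Longrightarrow> \<nu> (x i) \<ge> b"
      using ab[OF NM(2,1,4)] by auto
    have "(b - a) * (\<Sum>i<n. \<bar>t i\<bar>) = (\<Sum>i<n. (b - a) * \<bar>t i\<bar>)" by (simp add: sum_distrib_left)
    also have "\<dots> \<le> (\<Sum>i<n. t i * (\<mu> (x i) - \<nu> (x i)))"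
    proof (rule sum_mono)
      fix i assume "i \<in> {..<n}"
      then consider "i \<in> N" | "i \<in> M" by (force simp: N_def M_def)
      then show "(b - a) * \<bar>t i\<bar> \<le> t i * (\<mu> (x i) - \<nu> (x i))"
      proof cases
        case 1
        then have "b - a \<le> \<nu> (x i) - \<mu> (x i)" "t i < 0" using \<mu>(2) \<nu>(3) by (force simp: N_def)+
        then have "(b - a) * (- t i) \<le> (\<nu> (x i) - \<mu> (x i)) * (- t i)" by (intro mult_right_mono) auto
        then show ?thesis using \<open>t i < 0\<close> by (simp add: algebra_simps)
      next
        case 2
        then have "b - a \<le> \<mu> (x i) - \<nu> (x i)" "t i \<ge> 0" using \<mu>(3) \<nu>(2) by (force simp: M_def)+
        then have "(b - a) * t i \<le> (\<mu> (x i) - \<nu> (x i)) * t i" by (intro mult_right_mono) auto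
        then show ?thesis using \<open>t i \<ge> 0\<close> by (simp add: algebra_simps)
      qed
    qed
    also have "\<dots> = \<mu> ?s - \<nu> ?s"
      by (simp add: blinfun.sum_right blinfun.scaleR_right algebra_simps sum_subtractf)
    \<comment> \<open>Two functionals from the dual ball are used, whence the factor 1/2 in the
      constant.\<close>
    also have "\<dots> \<le> norm ?s + norm ?s"
    proof -
      have "\<bar>f ?s\<bar> \<le> norm ?s" if "norm f \<le> 1" for f :: "'v dual"
        using norm_blinfun[of f ?s] mult_left_le_one_le[of "norm ?s" "norm f"] that by simp
      from this[OF \<mu>(1)] this[OF \<nu>(1)] show ?thesis by linarith
    qed
    finally show ?thesis by simp
  qed
  have upper: "norm (\<Sum>i<n. t i *\<^sub>R x i) \<le> K * (\<Sum>i<n. \<bar>t i\<bar>)" for n and t :: "nat \<Rightarrow> real"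
  proof -
    have "norm (\<Sum>i<n. t i *\<^sub>R x i) \<le> (\<Sum>i<n. K * \<bar>t i\<bar>)"
      by (rule sum_norm_le) (use bdd in \<open>simp add: mult.commute[of K] mult_left_mono\<close>)
    then show ?thesis by (simp add: sum_distrib_left)
  qed
  show ?thesis
    unfolding l1_sequence_def
    by (rule exI[of _ "(b - a) / 2"], rule exI[of _ K]) (use \<open>a < b\<close> lower upper in auto)
qed

text \<open>The lower estimate is exactly what Helly's condition asks for prescribed values of
  modulus \<open>c\<close>. A tolerance of \<open>c / 2\<close> then leaves the levels
  \<open>- c / 2\<close> and \<open>c / 2\<close> apart.\<close>

lemma l1_sequence_imp_independent:
  fixes x :: "nat \<Rightarrow> 'v::real_normed_vector dual"
  assumes "l1_sequence x" and bdd: "\<And>n. norm (x n) \<le> K"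
  shows "independent_family_on (cball 0 1) (\<lambda>n (\<mu> :: 'v bidual). \<mu> (x n))"
proof -
  obtain c where "c > 0" and
    c: "\<And>n (t :: nat \<Rightarrow> real). c * (\<Sum>i<n. \<bar>t i\<bar>) \<le> norm (\<Sum>i<n. t i *\<^sub>R x i)"
    using assms(1) unfolding l1_sequence_def by blast
  have "\<bar>\<mu> (x n)\<bar> \<le> K" if "norm \<mu> \<le> 1" for \<mu> :: "'v bidual" and n
    using norm_blinfun[of \<mu> "x n"] mult_left_le_one_le[of "norm (x n)" "norm \<mu>"] that bdd[of n] by simp
  moreover have "\<exists>\<mu>\<in>cball (0 :: 'v bidual) 1. (\<forall>n\<in>N. \<mu> (x n) \<le> - c / 2) \<and> (\<forall>m\<in>M. \<mu> (x m) \<ge> c / 2)"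
    if NM: "finite N" "finite M" "N \<inter> M = {}" for N M
  proof -
    obtain n where n: "N \<union> M \<subseteq> {..<n}"
      using finite_nat_bounded[of "N \<union> M"] NM by auto
    \<comment> \<open>The estimate runs over an initial segment, so indices outside \<open>N\<close>
      and \<open>M\<close> need a value too; they receive \<open>c\<close>.\<close>
    define y where "y i = (if i \<in> N then - c else c)" for i
    have "(\<Sum>i<n. t i * y i) \<le> norm (\<Sum>i<n. t i *\<^sub>R x i)" for t :: "nat \<Rightarrow> real"
    proof -
      have "(\<Sum>i<n. t i * y i) \<le> (\<Sum>i<n. c * \<bar>t i\<bar>)"
      proof (rule sum_mono)
        fix i
        have "\<bar>y i\<bar> = c" using \<open>c > 0\<close> by (simp add: y_def)
        then show "t i * y i \<le> c * \<bar>t i\<bar>"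
          by (metis abs_ge_self abs_mult mult.commute)
      qed
      also have "\<dots> \<le> norm (\<Sum>i<n. t i *\<^sub>R x i)" using c[of t n] by (simp add: sum_distrib_left)
      finally show ?thesis .
    qed
    then obtain v where v: "norm v \<le> 1" and xv: "\<And>i. i < n \<Longrightarrow> \<bar>x i v - y i\<bar> \<le> c / 2"
      using helly[of "{..<n}" "c / 2" y x] \<open>c > 0\<close> by auto
    show ?thesis
    proof (intro bexI[of _ "eval_functional v"] conjI ballI)
      show "eval_functional v \<in> cball 0 1"
        using order_trans[OF norm_eval_functional_le v] by simp
      show "eval_functional v (x i) \<le> - c / 2" if "i \<in> N" for i
      proof -
        have "y i = - c" "i < n" using n that by (auto simp: y_def)
        then have "\<bar>x i v + c\<bar> \<le> c / 2" using xv[of i] by simp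
        then show ?thesis unfolding eval_functional.rep_eq by linarith
      qed
      show "eval_functional v (x i) \<ge> c / 2" if "i \<in> M" for i
      proof -
        have "y i = c" "i < n" using n NM(3) that by (auto simp: y_def)
        then have "\<bar>x i v - c\<bar> \<le> c / 2" using xv[of i] by simp
        then show ?thesis unfolding eval_functional.rep_eq by linarith
      qed
    qed
  qed
  ultimately show ?thesis
    unfolding independent_family_on_def using \<open>c > 0\<close>
    by (intro conjI exI[of _ K] exI[of _ "- c / 2"] exI[of _ "c / 2"]) auto
qed

section \<open>Tameness of an image and co-tameness of the adjoint image\<close>

lemma tame_image_iff_co_tame:
  fixes T :: "'u::banach \<Rightarrow> 'v::real_normed_vector dual" and S :: "'v bidual \<Rightarrow> 'u dual"
  assumes T: "bounded_linear T" and S: "\<And>\<mu> b. S \<mu> b = \<mu> (T b)"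
  shows "tame (T ` cball 0 1) \<longleftrightarrow> co_tame (S ` cball 0 1)"
proof -
  obtain K where K: "\<And>a. norm (T a) \<le> norm a * K" and "K \<ge> 0"
    using bounded_linear.nonneg_bounded[OF T] by metis
  have TK: "norm (T a) \<le> K" if "norm a \<le> 1" for a
    using K[of a] mult_right_mono[OF that \<open>K \<ge> 0\<close>] by simp
  then have "bounded (T ` cball 0 1)" by (auto simp: bounded_iff intro!: exI[of _ K])
  moreover have "compactin weak_star_topology (S ` cball 0 1)"
    using S by (rule compactin_image_bidual_cball)
  moreover have "l1_sequence (T \<circ> v) \<longleftrightarrow>
      independent_family_on (S ` cball 0 1) (\<lambda>n \<psi>. blinfun_apply \<psi> (v n))" if "range v \<subseteq> cball 0 1" for v
  proof -
    have "norm ((T \<circ> v) n) \<le> K" for n using that by (auto simp: image_subset_iff intro!: TK)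
    then have "l1_sequence (T \<circ> v) \<longleftrightarrow>
        independent_family_on (cball 0 1) (\<lambda>n (\<mu> :: 'v bidual). \<mu> ((T \<circ> v) n))"
      using l1_sequence_imp_independent independent_imp_l1_sequence by blast
    \<comment> \<open>A point \<open>S \<mu>\<close> takes the value \<open>\<mu> (T (v n))\<close>
      at \<open>v n\<close>, so quantifying over the image amounts to quantifying over the bidual
      ball.\<close>
    then show ?thesis by (simp add: independent_family_on_def S)
  qed
  moreover have "(\<exists>x. range x \<subseteq> T ` cball 0 1 \<and> P x) \<longleftrightarrow> (\<exists>v. range v \<subseteq> cball 0 1 \<and> P (T \<circ> v))"
    for P :: "(nat \<Rightarrow> 'v dual) \<Rightarrow> bool"
  \<comment> \<open>Choosing preimages lifts a sequence in the image to one in the ball.\<close>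
  proof safe
    fix x :: "nat \<Rightarrow> 'v dual" assume x: "range x \<subseteq> T ` cball 0 1" "P x"
    then have "\<forall>n. \<exists>a\<in>cball 0 1. x n = T a" by blast
    then obtain v where v: "\<And>n. v n \<in> cball 0 1" "\<And>n. x n = T (v n)" by metis
    then have "x = T \<circ> v" by auto
    then show "\<exists>v. range v \<subseteq> cball 0 1 \<and> P (T \<circ> v)" using v(1) x(2) by blast
  next
    fix v :: "nat \<Rightarrow> 'u" assume "range v \<subseteq> cball 0 1" "P (T \<circ> v)"
    then show "\<exists>x. range x \<subseteq> T ` cball 0 1 \<and> P x" by (intro exI[of _ "T \<circ> v"]) auto
  qed
  ultimately show ?thesis unfolding tame_def co_tame_def by metis
qed

theorem theorem4p7:
  fixes \<phi> :: "'a::{real_normed_algebra, banach} dual"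
  shows "(right_tame \<phi> \<longleftrightarrow> co_tame ((\<lambda>\<mu>. \<mu> \<triangleright>\<^sub>2 \<phi>) ` cball 0 1)) \<and>
         (\<lambda>\<mu>. \<mu> \<triangleright>\<^sub>2 \<phi>) ` cball 0 1 =
           weak_star_topology closure_of ((\<lambda>a. a \<triangleright> \<phi>) ` cball 0 1) \<and>
         (left_tame \<phi> \<longleftrightarrow> co_tame ((\<lambda>\<mu>. \<phi> \<triangleleft>\<^sub>2 \<mu>) ` cball 0 1))"
  unfolding right_tame_def left_tame_def
  \<comment> \<open>The evaluation rules identify the two bidual actions as adjoints of the two
    actions of the algebra. For the closure, \<open>a \<triangleright> \<phi>\<close> at
    \<open>b\<close> and \<open>\<phi> \<triangleleft> b\<close> at \<open>a\<close> are both
    \<open>\<phi> (b * a)\<close>.\<close>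
  by (intro conjI tame_image_iff_co_tame image_bidual_cball_eq_closure[where T = "\<lambda>a. \<phi> \<triangleleft> a"]
      bounded_linear_left_act bounded_linear_right_act) simp_all

end
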